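(* Let $k\in\mathbb{N}=\{1,2,\ldots\}$ and $j\in\mathbb{Z}_+$. The estimator $\hat h_{j,k}=V_j^k/N_j^k$ takes (almost surely) values in $\mathbb{Q}\cap[0,1)$, and its probability mass function is $$\mathbb{P}(\hat h_{j,k}=q)=(d_{j,k}-h_j)\sum_{i=1}^\infty\binom{bi-1}{ai}\,h_j^{ai}\,(1-d_{j,k})^{(b-a)i-1}$$ for all $q=a/b$ with $a,b\in\mathbb{Z}_+$, $a<b$ and $\gcd(a,b)=1$. Moreover, its cumulative distribution function on $[0,1)$ is $$G_{j,k}(x)=\mathbb{P}(\hat h_{j,k}\le x)=(d_{j,k}-h_j)\sum_{m=0}^\infty(1-d_{j,k})^m\sum_{\ell=0}^{\left\lfloor\frac{(1+m)x}{1-x}\right\rfloor}\binom{m+\ell}{\ell}h_j^\ell,\qquad x\in[0,1).$$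
   Context: $\mathbb{Z}_+=\{0,1,2,\ldots\}$. $X_1,X_2,\ldots$ are i.i.d. random variables with values in $\mathbb{Z}_+$ and infinite support; $P(i)=\mathbb{P}(X_1=i)$, $\overline F(i)=\mathbb{P}(X_1>i)$; $h_j=P(j)/\overline F(j-1)$ is the hazard rate; for $\ell\ge j$, $h_{\ell\vert j}=P(\ell)/\overline F(j-1)$ and $\overline F(\ell\vert j)=\overline F(\ell)/\overline F(j-1)$. Put $d_{j,k}=1-\sum_{i=1}^k h_{j+i\vert j}=h_j+\overline F(j+k\vert j)$. Convention $0^0=1$. Let $M_i=\max\{X_1,\ldots,X_i\}$. For $m\in\mathbb{Z}_+$ and $\ell=0,\ldots,k$ define, from the entire sequence, $A_m^0=\mathbf 1_{\{X_1=m\}}+\sum_{i=2}^\infty\mathbf 1_{\{X_i=m,\,M_{i-1}\le m\}}$; $A_m^\ell=\sum_{i=2}^\infty\mathbf 1_{\{X_i=m,\,M_{i-1}=m+\ell\}}$ for $\ell\ge1$; $V_m^\ell=\sum_{i=0}^\ell A_m^i$; $N_m^\ell=1+\sum_{i=0}^\ell V_{m+i}^{\ell-i}$. The estimator is $\hat h_{j,k}=V_j^k/N_j^k$. (It coincides with the estimator computed from the first $n$ records $R_1<\dots<R_n$ of the sequence and the observations $X_i$ with $M_{i-1}-k\le X_i\le M_{i-1}$ made before the $(n+1)$-th record, whenever $R_n\ge j+k$.) *)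

theory Defs
  imports "HOL-Probability.Probability"
begin

text \<open>
  The sequence is \<open>X 1, X 2, \<dots>\<close>; the entry \<open>X 0\<close> is never used.  The functions describing the
  common distribution take a single random variable \<open>Y\<close>, to be instantiated with \<open>X 1\<close>.
\<close>

definition point_mass :: "'a measure \<Rightarrow> ('a \<Rightarrow> nat) \<Rightarrow> nat \<Rightarrow> real" where
  "point_mass M Y i = measure M {\<omega> \<in> space M. Y \<omega> = i}"

text \<open>The argument is an integer, so that the tail at \<open>j - 1\<close> makes sense for \<open>j = 0\<close>.\<close>

definition tail_prob :: "'a measure \<Rightarrow> ('a \<Rightarrow> nat) \<Rightarrow> int \<Rightarrow> real" where
  "tail_prob M Y i = measure M {\<omega> \<in> space M. int (Y \<omega>) > i}"

definition hazard :: "'a measure \<Rightarrow> ('a \<Rightarrow> nat) \<Rightarrow> nat \<Rightarrow> real" where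
  "hazard M Y j = point_mass M Y j / tail_prob M Y (int j - 1)"

text \<open>\<open>cond_mass M Y l j\<close> is $h_{l \mid j}$, meant for \<open>l \<ge> j\<close>.\<close>

definition cond_mass :: "'a measure \<Rightarrow> ('a \<Rightarrow> nat) \<Rightarrow> nat \<Rightarrow> nat \<Rightarrow> real" where
  "cond_mass M Y l j = point_mass M Y l / tail_prob M Y (int j - 1)"

definition d_coeff :: "'a measure \<Rightarrow> ('a \<Rightarrow> nat) \<Rightarrow> nat \<Rightarrow> nat \<Rightarrow> real" where
  "d_coeff M Y j k = 1 - (\<Sum>i=1..k. cond_mass M Y (j + i) j)"

definition running_max :: "(nat \<Rightarrow> 'a \<Rightarrow> nat) \<Rightarrow> nat \<Rightarrow> 'a \<Rightarrow> nat" where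
  "running_max X i \<omega> = Max ((\<lambda>s. X s \<omega>) ` {1..i})"

text \<open>
  The counts are \<open>ennreal\<close>-valued: on a null event infinitely many observations may be counted.
  The series over $i \ge 2$ are written with the index shifted by two.
\<close>

definition A_count :: "(nat \<Rightarrow> 'a \<Rightarrow> nat) \<Rightarrow> nat \<Rightarrow> nat \<Rightarrow> 'a \<Rightarrow> ennreal" where
  "A_count X m l \<omega> =
     (if l = 0
      then of_bool (X 1 \<omega> = m)
         + (\<Sum>i. of_bool (X (i + 2) \<omega> = m \<and> running_max X (i + 1) \<omega> \<le> m))
      else (\<Sum>i. of_bool (X (i + 2) \<omega> = m \<and> running_max X (i + 1) \<omega> = m + l)))"

definition V_count :: "(nat \<Rightarrow> 'a \<Rightarrow> nat) \<Rightarrow> nat \<Rightarrow> nat \<Rightarrow> 'a \<Rightarrow> ennreal" where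
  "V_count X m l \<omega> = (\<Sum>i=0..l. A_count X m i \<omega>)"

definition N_count :: "(nat \<Rightarrow> 'a \<Rightarrow> nat) \<Rightarrow> nat \<Rightarrow> nat \<Rightarrow> 'a \<Rightarrow> ennreal" where
  "N_count X m l \<omega> = 1 + (\<Sum>i=0..l. V_count X (m + i) (l - i) \<omega>)"

text \<open>Only meaningful where \<open>N_count X j k \<omega> < \<infinity>\<close>.\<close>

definition hazard_est :: "(nat \<Rightarrow> 'a \<Rightarrow> nat) \<Rightarrow> nat \<Rightarrow> nat \<Rightarrow> 'a \<Rightarrow> real" where
  "hazard_est X j k \<omega> = enn2real (V_count X j k \<omega>) / enn2real (N_count X j k \<omega>)"

end

theory Submission
  imports Defs
begin

text \<open>
  Let \<open>n\<close> be the number of observations before the first one exceeding \<open>j + k\<close>.  The estimator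
  only sees the first \<open>n\<close> observations: if \<open>l\<close> of them equal \<open>j\<close> and \<open>m\<close> of them lie in
  \<open>{j<..j + k}\<close>, then it takes the value \<open>l / (1 + l + m)\<close>.  Summing over \<open>n\<close> the one-step
  recursion for the law of the two counts among the first \<open>n\<close> observations gives a
  Pascal-type recursion, so that the pair \<open>(l, m)\<close> has probability
  \<open>(d - h) * ((m + l) choose l) * h ^ l * (1 - d) ^ m\<close>.  Both formulas arise by summing this over
  the pairs with the required ratio.
\<close>

section \<open>Visit counts in finite prefixes of a sequence\<close>

definition hits :: "nat set \<Rightarrow> nat \<Rightarrow> (nat \<Rightarrow> nat) \<Rightarrow> nat" where
  "hits A n x = card {t \<in> {1..n}. x t \<in> A}"

lemma hits_0 [simp]: "hits A 0 x = 0"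
  by (simp add: hits_def)

lemma hits_Suc: "hits A (Suc n) x = hits A n x + of_bool (x (Suc n) \<in> A)"
proof -
  have "{t \<in> {1..Suc n}. x t \<in> A} =
      {t \<in> {1..n}. x t \<in> A} \<union> (if x (Suc n) \<in> A then {Suc n} else {})"
    by (auto simp: le_Suc_eq)
  then show ?thesis
    by (auto simp: hits_def)
qed

lemma hits_eq_0_iff: "hits A n x = 0 \<longleftrightarrow> (\<forall>t\<in>{1..n}. x t \<notin> A)"
  by (auto simp: hits_def)

text \<open>Turns a count into a function of the tuple of the first \<open>n\<close> observations,
  the form needed for measurability and independence of prefixes. The lower bound is
  \<open>Suc 0\<close> because the simplifier rewrites \<open>1\<close> to it.\<close>

lemma hits_restrict [simp]: "hits A n (restrict x {Suc 0..n}) = hits A n x"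
  unfolding hits_def by (rule arg_cong[where f=card]) auto

lemma hits_eq_sum: "hits A n x = (\<Sum>t<n. of_bool (x (Suc t) \<in> A))"
  by (induction n) (simp_all add: hits_Suc)

lemma hits_union: "A \<inter> B = {} \<Longrightarrow> hits (A \<union> B) n x = hits A n x + hits B n x"
  by (induction n) (auto simp: hits_Suc)

text \<open>\<open>n\<close> is the number of observations before the first one in \<open>S\<close>.\<close>

definition stops_with :: "nat set \<Rightarrow> nat set \<Rightarrow> nat set \<Rightarrow> nat \<Rightarrow> nat \<Rightarrow> nat \<Rightarrow> (nat \<Rightarrow> nat) \<Rightarrow> bool"
  where "stops_with S A B l m n x \<longleftrightarrow>
    hits S n x = 0 \<and> hits A n x = l \<and> hits B n x = m \<and> x (Suc n) \<in> S"

text \<open>Stopping at the smaller index puts a hit of \<open>S\<close> inside the longer prefix,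
  which has none. The counts may differ between the two assumptions since only \<open>S\<close>
  decides when to stop.\<close>

lemma stops_with_unique:
  assumes "stops_with S A B l m n x" "stops_with S A' B' l' m' n' x"
  shows "n = n'"
proof (rule ccontr)
  assume "n \<noteq> n'"
  then consider "Suc n \<in> {1..n'}" | "Suc n' \<in> {1..n}"
    by fastforce
  then show False
    using assms by cases (auto simp: stops_with_def hits_eq_0_iff)
qed

section \<open>I.i.d. sequences: independence of a prefix and the next observation\<close>

locale iid_nat_sequence = prob_space M for M :: "'a measure" +
  fixes X :: "nat \<Rightarrow> 'a \<Rightarrow> nat"
  assumes indep: "indep_vars (\<lambda>_. count_space UNIV) X {1..}"
    and ident: "i \<ge> 1 \<Longrightarrow> distr M (count_space UNIV) (X i) = distr M (count_space UNIV) (X 1)"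
begin

lemma X_measurable [measurable]: "i \<ge> 1 \<Longrightarrow> X i \<in> measurable M (count_space UNIV)"
  using indep by (auto simp: indep_vars_def)

lemma X_Suc_measurable [measurable]: "X (Suc i) \<in> measurable M (count_space UNIV)"
  by (rule X_measurable) simp

definition law :: "nat set \<Rightarrow> real" where
  "law C = prob {\<omega> \<in> space M. X 1 \<omega> \<in> C}"

lemma prob_X:
  assumes "i \<ge> 1"
  shows "prob {\<omega> \<in> space M. X i \<omega> \<in> C} = law C"
proof -
  have "prob {\<omega> \<in> space M. X i \<omega> \<in> C} = measure (distr M (count_space UNIV) (X i)) C"
    if "i \<ge> 1" for i
    using that by (subst measure_distr) (auto intro!: arg_cong[where f=prob])
  from this[OF assms] this[of 1] ident[OF assms] show ?thesis
    by (simp add: law_def)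
qed

lemma law_union: "C \<inter> D = {} \<Longrightarrow> law (C \<union> D) = law C + law D"
  unfolding law_def
  by (subst finite_measure_Union[symmetric]) (auto intro!: arg_cong[where f=prob])

text \<open>A finite product of counting spaces over the countable type \<open>nat\<close> is again
  a counting space, so every predicate \<open>Q\<close> of the prefix is measurable.\<close>

lemma prefix_measurable [measurable]:
  "{\<omega> \<in> space M. Q (restrict (\<lambda>i. X i \<omega>) {1..n})} \<in> events"
proof -
  have [measurable]: "(\<lambda>\<omega>. restrict (\<lambda>i. X i \<omega>) {1..n})
      \<in> measurable M (PiM {1..n} (\<lambda>_. count_space UNIV))"
    by (rule measurable_restrict) simp
  have "Measurable.pred (PiM {1..n} (\<lambda>_. count_space (UNIV :: nat set))) Q"
    by (subst count_space_PiM_finite) (simp_all add: pred_def)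
  then show ?thesis
    by measurable
qed

lemma hits_measurable [measurable]:
  "(\<lambda>\<omega>. hits A n (\<lambda>i. X i \<omega>)) \<in> measurable M (count_space UNIV)"
proof -
  have "(\<lambda>\<omega>. hits A n (\<lambda>i. X i \<omega>)) -` {v} \<inter> space M \<in> events" for v
    using prefix_measurable[of "\<lambda>x. hits A n x = v" n]
    by (simp add: vimage_def Int_def conj_commute)
  then show ?thesis
    by (auto simp: measurable_count_space_eq2_countable)
qed

text \<open>The index blocks \<open>{1..n}\<close> and \<open>{Suc n}\<close> are disjoint, so the
  two restrictions are independent. This is the only form in which independence enters the later
  computations.\<close>

lemma prob_prefix_next:
  "prob {\<omega> \<in> space M. Q (restrict (\<lambda>i. X i \<omega>) {1..n}) \<and> X (Suc n) \<omega> \<in> C} =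
    prob {\<omega> \<in> space M. Q (restrict (\<lambda>i. X i \<omega>) {1..n})} * law C"
proof -
  let ?N = "\<lambda>_. count_space (UNIV :: nat set)"
  let ?P = "\<lambda>\<omega>. restrict (\<lambda>i. X i \<omega>) {1..n}"
  let ?R = "\<lambda>\<omega>. restrict (\<lambda>i. X i \<omega>) {Suc n}"
  have *: "PiM J ?N = count_space (PiE J (\<lambda>_. UNIV))" if "finite J" for J :: "nat set"
    using that by (rule count_space_PiM_finite) simp
  have "indep_var (PiM {1..n} ?N) ?P (PiM {Suc n} ?N) ?R"
    by (rule indep_var_restrict[OF indep]) auto
  then have "prob ((\<lambda>\<omega>. (?P \<omega>, ?R \<omega>)) -` ({x \<in> PiE {1..n} (\<lambda>_. UNIV). Q x} \<times>
        {x \<in> PiE {Suc n} (\<lambda>_. UNIV). x (Suc n) \<in> C}) \<inter> space M) =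
      prob (?P -` {x \<in> PiE {1..n} (\<lambda>_. UNIV). Q x} \<inter> space M) *
      prob (?R -` {x \<in> PiE {Suc n} (\<lambda>_. UNIV). x (Suc n) \<in> C} \<inter> space M)"
    by (rule indep_varD) (auto simp: *)
  moreover have "?R -` {x \<in> PiE {Suc n} (\<lambda>_. UNIV). x (Suc n) \<in> C} \<inter> space M =
      {\<omega> \<in> space M. X (Suc n) \<omega> \<in> C}"
    by auto
  moreover have "prob {\<omega> \<in> space M. X (Suc n) \<omega> \<in> C} = law C"
    by (rule prob_X) simp
  ultimately have prod: "prob ((\<lambda>\<omega>. (?P \<omega>, ?R \<omega>)) -` ({x \<in> PiE {1..n} (\<lambda>_. UNIV). Q x} \<times>
        {x \<in> PiE {Suc n} (\<lambda>_. UNIV). x (Suc n) \<in> C}) \<inter> space M) =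
      prob (?P -` {x \<in> PiE {1..n} (\<lambda>_. UNIV). Q x} \<inter> space M) * law C"
    by simp
  have "?P \<omega> \<in> PiE {1..n} (\<lambda>_. UNIV)" "?R \<omega> \<in> PiE {Suc n} (\<lambda>_. UNIV)" for \<omega>
    by simp_all
  then have "(\<lambda>\<omega>. (?P \<omega>, ?R \<omega>)) -` ({x \<in> PiE {1..n} (\<lambda>_. UNIV). Q x} \<times>
        {x \<in> PiE {Suc n} (\<lambda>_. UNIV). x (Suc n) \<in> C}) \<inter> space M =
      {\<omega> \<in> space M. Q (?P \<omega>) \<and> X (Suc n) \<omega> \<in> C}"
    and "?P -` {x \<in> PiE {1..n} (\<lambda>_. UNIV). Q x} \<inter> space M = {\<omega> \<in> space M. Q (?P \<omega>)}"
    by auto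
  then show ?thesis
    using prod by (simp only:)
qed

end

section \<open>Law of the two counts at the stopping index\<close>

locale stopped_iid_nat_sequence = iid_nat_sequence +
  fixes S A B :: "nat set"
  assumes disjoint: "S \<inter> A = {}" "S \<inter> B = {}" "A \<inter> B = {}"
    and law_S_pos: "law S > 0"
begin

text \<open>
  The offsets \<open>u\<close> and \<open>v\<close> stand for the contribution of observation \<open>n + 1\<close> to the counts; they
  let the recursion be stated without predecessors of \<open>l\<close> and \<open>m\<close>.
\<close>

definition alive :: "nat \<Rightarrow> nat \<Rightarrow> nat \<Rightarrow> nat \<Rightarrow> nat \<Rightarrow> 'a set" where
  "alive u v l m n = {\<omega> \<in> space M. hits S n (\<lambda>i. X i \<omega>) = 0 \<and>
    hits A n (\<lambda>i. X i \<omega>) + u = l \<and> hits B n (\<lambda>i. X i \<omega>) + v = m}"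

definition stopped :: "nat \<Rightarrow> nat \<Rightarrow> 'a set" where
  "stopped l m = {\<omega> \<in> space M. \<exists>n. stops_with S A B l m n (\<lambda>i. X i \<omega>)}"

lemma alive_measurable [measurable]: "alive u v l m n \<in> events"
  unfolding alive_def by measurable

lemma stopped_measurable [measurable]: "stopped l m \<in> events"
  unfolding stopped_def stops_with_def by measurable

lemma prob_alive_next:
  "prob (alive u v l m n \<inter> {\<omega> \<in> space M. X (Suc n) \<omega> \<in> C}) = prob (alive u v l m n) * law C"
  using prob_prefix_next[of "\<lambda>x. hits S n x = 0 \<and> hits A n x + u = l \<and> hits B n x + v = m" n C]
  by (simp add: alive_def Int_def conj_ac)

text \<open>Observation \<open>n + 1\<close> lies outside \<open>A\<close>, \<open>B\<close> and
  \<open>S\<close>, or in \<open>A\<close>, or in \<open>B\<close>; it cannot lie in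
  \<open>S\<close>. Each case is a condition on the prefix intersected with one on the next
  observation, so its probability factors.\<close>

lemma prob_alive_Suc:
  "prob (alive 0 0 l m (Suc n)) =
    (1 - (law A + law B + law S)) * prob (alive 0 0 l m n)
    + law A * prob (alive 1 0 l m n) + law B * prob (alive 0 1 l m n)"
proof -
  let ?E = "\<lambda>C. {\<omega> \<in> space M. X (Suc n) \<omega> \<in> C}"
  let ?R = "- (A \<union> B \<union> S)"
  have [measurable]: "?E C \<in> events" for C
    by measurable
  have "law (?R \<union> (A \<union> B \<union> S)) = law ?R + (law A + law B + law S)"
    using disjoint by (subst law_union, blast)+ simp
  moreover have "law (?R \<union> (A \<union> B \<union> S)) = 1"
    unfolding Compl_partition2 by (simp add: law_def prob_space)
  ultimately have R: "law ?R = 1 - (law A + law B + law S)"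
    by simp
  define P where "P = alive 0 0 l m n \<inter> ?E ?R"
  define Q where "Q = alive 1 0 l m n \<inter> ?E A"
  define T where "T = alive 0 1 l m n \<inter> ?E B"
  have [measurable]: "P \<in> events" "Q \<in> events" "T \<in> events"
    unfolding P_def Q_def T_def by measurable
  have "alive 0 0 l m (Suc n) = P \<union> Q \<union> T"
    using disjoint by (auto simp: alive_def hits_Suc P_def Q_def T_def split: if_splits)
  moreover have "P \<inter> Q = {}" "(P \<union> Q) \<inter> T = {}"
    using disjoint by (auto simp: P_def Q_def T_def)
  ultimately have "prob (alive 0 0 l m (Suc n)) = prob P + prob Q + prob T"
    by (simp add: finite_measure_Union)
  moreover have "prob P = prob (alive 0 0 l m n) * (1 - (law A + law B + law S))"
    unfolding P_def prob_alive_next R ..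
  moreover have "prob Q = prob (alive 1 0 l m n) * law A" "prob T = prob (alive 0 1 l m n) * law B"
    unfolding Q_def T_def prob_alive_next by simp_all
  ultimately show ?thesis
    by (simp only: mult.commute)
qed

text \<open>The stopping index is unique, so the events of stopping after exactly \<open>n\<close>
  observations are disjoint; each of them has a probability that factors.\<close>

lemma stopped_sums: "(\<lambda>n. prob (alive 0 0 l m n) * law S) sums prob (stopped l m)"
proof -
  let ?F = "\<lambda>n. alive 0 0 l m n \<inter> {\<omega> \<in> space M. X (Suc n) \<omega> \<in> S}"
  have F: "?F n = {\<omega> \<in> space M. stops_with S A B l m n (\<lambda>i. X i \<omega>)}" for n
    by (auto simp: alive_def stops_with_def)
  have "disjoint_family ?F"
    unfolding disjoint_family_on_def F using stops_with_unique by blast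
  then have "(\<lambda>n. prob (?F n)) sums prob (\<Union>n. ?F n)"
    by (intro finite_measure_UNION) auto
  also have "(\<Union>n. ?F n) = stopped l m"
    unfolding F by (auto simp: stopped_def)
  finally show ?thesis
    by (simp add: prob_alive_next)
qed

text \<open>In the application this is the probability of a value at least \<open>j\<close>, the
  common denominator of the hazard coefficients.\<close>

definition total :: real where "total = law A + law B + law S"

lemma total_pos: "total > 0"
  using law_S_pos by (simp add: total_def law_def add_nonneg_pos)

text \<open>Multiply the one-step recursion by \<open>law S\<close> and sum over \<open>n\<close>.
  An offset of one becomes a decrement of \<open>l\<close> or \<open>m\<close>, or makes the event
  empty if that count is zero; the indicator is the contribution of the empty prefix.\<close>

lemma stopped_recurrence:
  "total * prob (stopped l m) = law S * of_bool (l = 0 \<and> m = 0)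
    + (if l = 0 then 0 else law A * prob (stopped (l - 1) m))
    + (if m = 0 then 0 else law B * prob (stopped l (m - 1)))"
proof -
  let ?p = "\<lambda>u v n. prob (alive u v l m n) * law S"
  define a where "a = (if l = 0 then 0 else prob (stopped (l - 1) m))"
  define b where "b = (if m = 0 then 0 else prob (stopped l (m - 1)))"
  have *: "?p 0 0 sums prob (stopped l m)"
    by (rule stopped_sums)
  have "?p 1 0 sums a"
  proof (cases l)
    case 0
    then have "alive 1 0 l m n = {}" for n
      by (simp add: alive_def)
    then show ?thesis
      using 0 by (simp add: a_def)
  next
    case (Suc l')
    then have "alive 1 0 l m n = alive 0 0 l' m n" for n
      by (simp add: alive_def)
    then show ?thesis
      using Suc stopped_sums[of l' m] by (simp add: a_def)
  qed
  moreover have "?p 0 1 sums b"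
  proof (cases m)
    case 0
    then have "alive 0 1 l m n = {}" for n
      by (simp add: alive_def)
    then show ?thesis
      using 0 by (simp add: b_def)
  next
    case (Suc m')
    then have "alive 0 1 l m n = alive 0 0 l m' n" for n
      by (simp add: alive_def)
    then show ?thesis
      using Suc stopped_sums[of l m'] by (simp add: b_def)
  qed
  ultimately have "(\<lambda>n. (1 - total) * ?p 0 0 n + law A * ?p 1 0 n + law B * ?p 0 1 n) sums
      ((1 - total) * prob (stopped l m) + law A * a + law B * b)"
    using * by (intro sums_add sums_mult)
  moreover have "(1 - total) * ?p 0 0 n + law A * ?p 1 0 n + law B * ?p 0 1 n = ?p 0 0 (Suc n)" for n
    by (simp add: prob_alive_Suc total_def algebra_simps)
  ultimately have "(\<lambda>n. ?p 0 0 (Suc n)) sums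
      ((1 - total) * prob (stopped l m) + law A * a + law B * b)"
    by simp
  moreover have "?p 0 0 0 = law S * of_bool (l = 0 \<and> m = 0)"
    by (auto simp: alive_def prob_space)
  \<comment> \<open>A second evaluation of the shifted series, as the full series without its first
    term; equating it with the first one gives the recurrence.\<close>
  moreover have "(\<lambda>n. ?p 0 0 (Suc n)) sums (prob (stopped l m) - ?p 0 0 0)"
    using * by (subst sums_Suc_iff) simp
  ultimately have "prob (stopped l m) - law S * of_bool (l = 0 \<and> m = 0) =
      (1 - total) * prob (stopped l m) + law A * a + law B * b"
    using sums_unique2 by metis
  then show ?thesis
    by (auto simp: a_def b_def algebra_simps)
qed

text \<open>The closed form solves the recurrence, by induction on \<open>l + m\<close>. On the
  boundary only one predecessor remains and the binomial coefficient is 1.\<close>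

theorem prob_stopped:
  "prob (stopped l m) =
    law S / total * (real ((m + l) choose l) * (law A / total) ^ l * (law B / total) ^ m)"
proof (induction "l + m" arbitrary: l m rule: less_induct)
  case less
  have rec: "prob (stopped l m) = law S / total * of_bool (l = 0 \<and> m = 0)
    + (if l = 0 then 0 else law A / total * prob (stopped (l - 1) m))
    + (if m = 0 then 0 else law B / total * prob (stopped l (m - 1)))"
    using stopped_recurrence[of l m] total_pos by (auto simp: field_simps)
  show ?case
  proof (cases l; cases m)
    assume "l = 0" "m = 0"
    then show ?thesis using rec by simp
  next
    fix m' assume "l = 0" "m = Suc m'"
    then show ?thesis using rec less[of l m'] by simp
  next
    fix l' assume "l = Suc l'" "m = 0"
    then show ?thesis using rec less[of l' m] by simp
  next
    fix l' m' assume lm: "l = Suc l'" "m = Suc m'"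
    \<comment> \<open>Pascal's rule, using that \<open>m + l'\<close> and \<open>m' + l\<close> are
      the same number.\<close>
    have "real ((m + l) choose l) = real ((m + l') choose l') + real ((m' + l) choose l)"
      by (simp add: lm)
    moreover have "prob (stopped l m) = law A / total * prob (stopped l' m)
        + law B / total * prob (stopped l m')"
      using rec by (simp add: lm)
    moreover have "prob (stopped l' m) = law S / total * (real ((m + l') choose l')
        * (law A / total) ^ l' * (law B / total) ^ m)"
      "prob (stopped l m') = law S / total * (real ((m' + l) choose l)
        * (law A / total) ^ l * (law B / total) ^ m')"
      by (rule less; simp add: lm)+
    moreover have "(law A / total) ^ l = law A / total * (law A / total) ^ l'"
      "(law B / total) ^ m = law B / total * (law B / total) ^ m'"
      by (simp_all add: lm)
    ultimately show ?thesis
      by (simp only: distrib_left distrib_right mult_ac)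
  qed
qed

section \<open>Almost sure stopping and summation over pairs of counts\<close>

text \<open>By independence, avoiding \<open>S\<close> for \<open>n\<close> steps has probability
  \<open>(1 - law S) ^ n\<close>, which tends to 0 because \<open>law S\<close> is positive.\<close>

lemma AE_stopped: "AE \<omega> in M. \<exists>l m. \<omega> \<in> stopped l m"
proof -
  let ?Z = "{\<omega> \<in> space M. \<forall>t\<ge>1. X t \<omega> \<notin> S}"
  let ?Zn = "\<lambda>n. {\<omega> \<in> space M. hits S n (\<lambda>i. X i \<omega>) = 0}"
  have Zn: "prob (?Zn n) = (1 - law S) ^ n" for n
  proof (induction n)
    case (Suc n)
    have "law (S \<union> - S) = law S + law (- S)"
      by (rule law_union) simp
    then have "law (- S) = 1 - law S"
      by (simp add: law_def prob_space)
    moreover have "?Zn (Suc n) = {\<omega> \<in> space M. hits S n (\<lambda>i. X i \<omega>) = 0 \<and> X (Suc n) \<omega> \<in> - S}"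
      by (auto simp: hits_Suc)
    ultimately show ?case
      using prob_prefix_next[of "\<lambda>x. hits S n x = 0" n "- S"] Suc by simp
  qed (simp add: prob_space)
  have [measurable]: "?Z \<in> events"
    by measurable
  have "prob ?Z \<le> (1 - law S) ^ n" for n
    unfolding Zn[symmetric] by (rule finite_measure_mono) (auto simp: hits_eq_0_iff)
  moreover have "(\<lambda>n. (1 - law S) ^ n) \<longlonglongrightarrow> 0"
    using law_S_pos by (intro LIMSEQ_realpow_zero) (auto simp: law_def prob_le_1)
  ultimately have "prob ?Z \<le> 0"
    by (intro LIMSEQ_le_const) auto
  then have "prob ?Z = 0"
    by (simp add: measure_le_0_iff)
  then have "AE \<omega> in M. \<omega> \<notin> ?Z"
    by (subst (asm) prob_eq_0) auto
  then show ?thesis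
  proof (rule AE_mp, intro AE_I2 impI)
    fix \<omega> assume \<omega>: "\<omega> \<in> space M" "\<omega> \<notin> ?Z"
    let ?P = "\<lambda>n. X (Suc n) \<omega> \<in> S"
    from \<omega> obtain t where "t \<ge> 1" "X t \<omega> \<in> S"
      by auto
    then have ex: "?P (t - 1)"
      by simp
    \<comment> \<open>The first visit to \<open>S\<close> has index \<open>Suc n\<close>, so the
      prefix of length \<open>n\<close> avoids \<open>S\<close>, and \<open>l\<close> and
      \<open>m\<close> can be read off from it.\<close>
    define n where "n = (LEAST n. ?P n)"
    have "?P n"
      unfolding n_def using ex by (rule LeastI)
    moreover have "X s \<omega> \<notin> S" if "s \<in> {1..n}" for s
      using not_less_Least[of "s - 1" ?P] that unfolding n_def by fastforce
    ultimately have "stops_with S A B (hits A n (\<lambda>i. X i \<omega>)) (hits B n (\<lambda>i. X i \<omega>)) n (\<lambda>i. X i \<omega>)"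
      by (simp add: stops_with_def hits_eq_0_iff)
    then show "\<exists>l m. \<omega> \<in> stopped l m"
      using \<omega> by (auto simp: stopped_def)
  qed
qed

lemma stopped_disjoint:
  assumes "\<omega> \<in> stopped l m" "\<omega> \<in> stopped l' m'"
  shows "l = l' \<and> m = m'"
proof -
  obtain n n' where *: "stops_with S A B l m n (\<lambda>i. X i \<omega>)" "stops_with S A B l' m' n' (\<lambda>i. X i \<omega>)"
    using assms by (auto simp: stopped_def)
  then have "n = n'"
    by (rule stops_with_unique)
  then show ?thesis
    using * by (simp add: stops_with_def)
qed

text \<open>Up to a null set, \<open>E\<close> is a disjoint union of events
  \<open>stopped l m\<close>. Grouping the pairs into finite blocks \<open>C i\<close> yields a
  series in the desired index: singletons for the mass function, and for the distribution function
  finite ranges of \<open>l\<close> at fixed \<open>m\<close>.\<close>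

lemma sums_prob_stopped:
  assumes fin: "\<And>i :: nat. finite (C i)" and disj: "disjoint_family C"
    and [measurable]: "E \<in> events"
    and E: "\<And>\<omega> l m. \<omega> \<in> stopped l m \<Longrightarrow> \<omega> \<in> E \<longleftrightarrow> (l, m) \<in> (\<Union>i. C i)"
  shows "(\<lambda>i. \<Sum>(l, m)\<in>C i. prob (stopped l m)) sums prob E"
proof -
  define D where "D i = (\<Union>p\<in>C i. stopped (fst p) (snd p))" for i
  have [measurable]: "D i \<in> events" for i
    unfolding D_def using fin by (intro sets.finite_UN) auto
  have "prob (D i) = (\<Sum>p\<in>C i. prob (stopped (fst p) (snd p)))" for i
    unfolding D_def
  proof (rule finite_measure_finite_Union)
    show "disjoint_family_on (\<lambda>p. stopped (fst p) (snd p)) (C i)"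
      by (auto simp: disjoint_family_on_def dest: stopped_disjoint)
  qed (use fin in auto)
  moreover have "disjoint_family D"
    unfolding disjoint_family_on_def
  proof (intro ballI impI)
    fix i i' :: nat assume "i \<noteq> i'"
    then have "C i \<inter> C i' = {}"
      using disj by (simp add: disjoint_family_on_def)
    then have "p \<noteq> p'" if "p \<in> C i" "p' \<in> C i'" for p p'
      using that by blast
    then show "D i \<inter> D i' = {}"
      by (auto simp: D_def dest: stopped_disjoint)
  qed
  then have "(\<lambda>i. prob (D i)) sums prob (\<Union>i. D i)"
    by (intro finite_measure_UNION) auto
  \<comment> \<open>Equality holds only almost everywhere: nothing is known about \<open>E\<close>
    outside the events \<open>stopped l m\<close>.\<close>
  moreover have "prob (\<Union>i. D i) = prob E"
  proof (rule finite_measure_eq_AE)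
    show "AE \<omega> in M. \<omega> \<in> (\<Union>i. D i) \<longleftrightarrow> \<omega> \<in> E"
      using AE_stopped
    proof (rule AE_mp, intro AE_I2 impI)
      fix \<omega> assume "\<exists>l m. \<omega> \<in> stopped l m"
      then obtain l m where lm: "\<omega> \<in> stopped l m"
        by auto
      then have "\<omega> \<in> D i \<longleftrightarrow> (l, m) \<in> C i" for i
        by (auto simp: D_def dest: stopped_disjoint intro!: bexI[of _ "(l, m)"])
      then show "\<omega> \<in> (\<Union>i. D i) \<longleftrightarrow> \<omega> \<in> E"
        using E[OF lm] by simp
    qed
  qed auto
  ultimately show ?thesis
    by (simp add: case_prod_unfold)
qed

end

section \<open>The estimator in terms of the stopped counts\<close>

lemma running_max_le_iff:
  "running_max X (Suc i) \<omega> \<le> c \<longleftrightarrow> hits {c<..} (Suc i) (\<lambda>i. X i \<omega>) = 0"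
  by (auto simp: running_max_def hits_eq_0_iff not_less)

text \<open>The summands of \<open>V_count\<close> sort the observations equal to \<open>m\<close>
  by the excess of the previous maximum over \<open>m\<close>; together they only require this
  maximum to be at most \<open>m + l\<close>. For the first observation the prefix is empty and the
  condition is vacuous, which absorbs the separate term for \<open>X 1\<close>.\<close>

lemma V_count_eq_suminf:
  "V_count X m l \<omega> =
    (\<Sum>i. of_bool (X (Suc i) \<omega> = m \<and> hits {m + l<..} i (\<lambda>i. X i \<omega>) = 0))"
proof -
  define f :: "nat \<Rightarrow> nat \<Rightarrow> ennreal" where
    "f l i = of_bool (X (Suc i) \<omega> = m \<and> hits {m + l<..} i (\<lambda>i. X i \<omega>) = 0)" for l i
  have f: "suminf (f l) = of_bool (X 1 \<omega> = m) + (\<Sum>i. f l (Suc i))" for l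
    using suminf_offset[of "f l" 1] by (simp add: f_def add.commute)
  have "V_count X m l \<omega> = suminf (f l)"
  proof (induction l)
    case 0
    show ?case
      unfolding f by (simp add: V_count_def A_count_def f_def running_max_le_iff)
  next
    case (Suc l)
    let ?g = "\<lambda>i. of_bool (X (i + 2) \<omega> = m \<and> running_max X (i + 1) \<omega> = m + Suc l) :: ennreal"
    have "f (Suc l) (Suc i) = f l (Suc i) + ?g i" for i
    proof -
      have "running_max X (Suc i) \<omega> = m + Suc l \<longleftrightarrow>
          running_max X (Suc i) \<omega> \<le> m + Suc l \<and> \<not> running_max X (Suc i) \<omega> \<le> m + l"
        by auto
      moreover have "running_max X (Suc i) \<omega> \<le> m + Suc l" if "running_max X (Suc i) \<omega> \<le> m + l"
        using that by simp
      ultimately show ?thesis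
        unfolding f_def running_max_le_iff[symmetric] by auto
    qed
    then have "(\<Sum>i. f (Suc l) (Suc i)) = (\<Sum>i. f l (Suc i)) + (\<Sum>i. ?g i)"
      by (simp add: suminf_add)
    moreover have "V_count X m (Suc l) \<omega> = suminf (f l) + (\<Sum>i. ?g i)"
      using Suc by (simp add: V_count_def A_count_def)
    ultimately show ?case
      unfolding f by (simp add: add.assoc)
  qed
  then show ?thesis
    by (simp add: f_def[abs_def])
qed

text \<open>The series is finite: observation \<open>n + 1\<close> exceeds \<open>m + i\<close>, so
  it differs from \<open>m\<close> and blocks all later terms. Before that, the condition on the
  maximum holds automatically.\<close>

lemma V_count_stopped:
  assumes "stops_with {m + i<..} A B a b n (\<lambda>i. X i \<omega>)"
  shows "V_count X m i \<omega> = of_nat (hits {m} n (\<lambda>i. X i \<omega>))"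
proof -
  let ?x = "\<lambda>i. X i \<omega>"
  have before: "hits {m + i<..} t ?x = 0" if "t \<le> n" for t
    using assms that by (auto simp: stops_with_def hits_eq_0_iff)
  have after: "hits {m + i<..} t ?x \<noteq> 0" if "t > n" for t
    using assms that by (auto simp: stops_with_def hits_eq_0_iff intro!: bexI[of _ "Suc n"])
  have "V_count X m i \<omega> =
      (\<Sum>t<n. of_bool (X (Suc t) \<omega> = m \<and> hits {m + i<..} t ?x = 0))"
    unfolding V_count_eq_suminf
  proof (rule suminf_finite)
    fix t assume "t \<notin> {..<n}"
    then consider "t = n" | "t > n"
      by fastforce
    then show "of_bool (X (Suc t) \<omega> = m \<and> hits {m + i<..} t ?x = 0) = (0 :: ennreal)"
      using after assms by cases (auto simp: stops_with_def)
  qed simp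
  also have "\<dots> = (\<Sum>t<n. of_bool (X (Suc t) \<omega> \<in> {m}))"
    using before by (intro sum.cong) auto
  also have "\<dots> = of_nat (hits {m} n ?x)"
    unfolding hits_eq_sum of_nat_sum of_nat_of_bool ..
  finally show ?thesis .
qed

text \<open>All summands share the ceiling \<open>(j + i) + (k - i) = j + k\<close>, so one stopping
  index serves every one of them.\<close>

lemma N_count_stopped:
  assumes "stops_with {j + k<..} A B a b n (\<lambda>i. X i \<omega>)"
  shows "N_count X j k \<omega> = of_nat (1 + hits {j..j + k} n (\<lambda>i. X i \<omega>))"
proof -
  let ?x = "\<lambda>i. X i \<omega>"
  have sum_hits: "(\<Sum>i=0..r. hits {j + i} n ?x) = hits {j..j + r} n ?x" for r
  proof (induction r)
    case (Suc r)
    have "{j..j + Suc r} = {j..j + r} \<union> {j + Suc r}"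
      by auto
    moreover have "hits ({j..j + r} \<union> {j + Suc r}) n ?x =
        hits {j..j + r} n ?x + hits {j + Suc r} n ?x"
      by (rule hits_union) auto
    ultimately show ?case
      using Suc by simp
  qed simp
  have "V_count X (j + i) (k - i) \<omega> = of_nat (hits {j + i} n ?x)" if "i \<in> {0..k}" for i
    using that assms by (intro V_count_stopped[of _ _ A B a b]) simp
  then show ?thesis
    by (simp add: N_count_def flip: sum_hits)
qed

lemma counts_stopped:
  assumes "stops_with {j + k<..} {j} {j<..j + k} l m n (\<lambda>i. X i \<omega>)"
  shows "V_count X j k \<omega> = of_nat l" "N_count X j k \<omega> = of_nat (1 + l + m)"
    and "hazard_est X j k \<omega> = real l / real (1 + l + m)"
proof -
  let ?x = "\<lambda>i. X i \<omega>"
  show V: "V_count X j k \<omega> = of_nat l"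
    using V_count_stopped[where X = X and \<omega> = \<omega>, OF assms] assms by (simp add: stops_with_def)
  have "{j..j + k} = {j} \<union> {j<..j + k}"
    by auto
  then have "hits {j..j + k} n ?x = l + m"
    using hits_union[of "{j}" "{j<..j + k}" n ?x] assms by (simp add: stops_with_def)
  then show N: "N_count X j k \<omega> = of_nat (1 + l + m)"
    using N_count_stopped[where X = X and \<omega> = \<omega>, OF assms] by simp
  show "hazard_est X j k \<omega> = real l / real (1 + l + m)"
    unfolding hazard_est_def V N enn2real_of_nat ..
qed

lemma (in iid_nat_sequence) hazard_est_measurable [measurable]:
  "hazard_est X j k \<in> borel_measurable M"
proof -
  have [measurable]: "V_count X m l \<in> borel_measurable M" for m l
    unfolding V_count_eq_suminf[abs_def] by measurable
  show ?thesis
    unfolding hazard_est_def[abs_def] N_count_def[abs_def] by measurable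
qed

section \<open>Arithmetic of the ratio \<open>l / (1 + l + m)\<close>\<close>

text \<open>Identifies \<open>m + l\<close>, the upper index of the binomial coefficient, for the
  pairs with ratio \<open>a / b\<close>. The truncated subtraction is exact because
  \<open>a < b\<close>.\<close>

lemma numerator_add_index:
  fixes a b i :: nat
  assumes "a < b"
  shows "(b - a) * Suc i - 1 + a * Suc i = b * Suc i - 1"
proof -
  have "(b - a) * Suc i + a * Suc i = b * Suc i"
    using assms by (simp flip: add_mult_distrib)
  moreover have "(b - a) * Suc i \<ge> 1"
    using assms by simp
  ultimately show ?thesis
    by linarith
qed

text \<open>Cross-multiplication gives \<open>l * b = a * (1 + l + m)\<close>, and coprimality makes
  \<open>b\<close> divide \<open>1 + l + m\<close>. The quotient is positive, hence of the form
  \<open>Suc i\<close>.\<close>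

lemma ratio_eq_iff:
  fixes a b l m :: nat
  assumes "a < b" "coprime a b"
  shows "real l / real (1 + l + m) = real a / real b \<longleftrightarrow>
    (\<exists>i. l = a * Suc i \<and> m = (b - a) * Suc i - 1)"
proof
  assume "real l / real (1 + l + m) = real a / real b"
  then have "real (l * b) = real (a * (1 + l + m))"
    using assms by (simp add: field_simps)
  then have eq: "l * b = a * (1 + l + m)"
    by (simp only: of_nat_eq_iff)
  then have "b dvd 1 + l + m"
    using assms by (metis coprime_commute coprime_dvd_mult_right_iff dvd_triv_right)
  then obtain i where i: "1 + l + m = b * i"
    by (auto simp: dvd_def)
  then obtain i' where i': "i = Suc i'"
    by (cases i) auto
  have "l = a * i"
    using eq assms unfolding i by simp
  moreover from this have "m = (b - a) * i - 1"
    using i by (simp add: diff_mult_distrib)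
  ultimately show "\<exists>i. l = a * Suc i \<and> m = (b - a) * Suc i - 1"
    unfolding i' by blast
next
  assume "\<exists>i. l = a * Suc i \<and> m = (b - a) * Suc i - 1"
  then obtain i where i: "l = a * Suc i" "m = (b - a) * Suc i - 1"
    by auto
  have D: "1 + l + m = b * Suc i"
  proof -
    have "b * Suc i \<ge> 1"
      using assms(1) by simp
    then show ?thesis
      unfolding i using numerator_add_index[OF assms(1), of i] by linarith
  qed
  show "real l / real (1 + l + m) = real a / real b"
    unfolding D unfolding i(1) of_nat_mult by (subst mult_divide_mult_cancel_right) simp_all
qed

text \<open>Solve the inequality for \<open>l\<close>, using \<open>1 - x > 0\<close>. The bound is
  nonnegative, so \<open>nat\<close> does not alter its floor.\<close>

lemma ratio_le_iff:
  fixes x :: real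
  assumes "0 \<le> x" "x < 1"
  shows "real l / real (1 + l + m) \<le> x \<longleftrightarrow> l \<le> nat \<lfloor>(1 + real m) * x / (1 - x)\<rfloor>"
proof -
  have "real l / real (1 + l + m) \<le> x \<longleftrightarrow> real l \<le> (1 + real m) * x / (1 - x)"
    using assms by (simp add: field_simps)
  also have "\<dots> \<longleftrightarrow> l \<le> nat \<lfloor>(1 + real m) * x / (1 - x)\<rfloor>"
    using assms by (simp add: le_nat_iff le_floor_iff)
  finally show ?thesis .
qed

text \<open>Pulls the factor \<open>d - h\<close> out of a series; it must be nonzero for
  summability to pass to \<open>f\<close>.\<close>

lemma sums_cmult_left_D:
  fixes c :: real
  assumes "(\<lambda>i. c * f i) sums s" "c \<noteq> 0"
  shows "summable f \<and> s = c * suminf f"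
proof -
  have "f sums (s / c)"
    using sums_divide[OF assms(1), of c] assms(2) by simp
  then show ?thesis
    using assms(2) by (simp add: sums_iff)
qed

section \<open>Hazard coefficients and the two formulas\<close>

theorem theorem3p3:
  fixes M :: "'a measure" and X :: "nat \<Rightarrow> 'a \<Rightarrow> nat" and j k :: nat
  assumes "prob_space M"
    and "prob_space.indep_vars M (\<lambda>_. count_space UNIV) X {1..}"
    and "\<forall>i\<ge>1. distr M (count_space UNIV) (X i) = distr M (count_space UNIV) (X 1)"
    and "infinite {i. point_mass M (X 1) i > 0}"
    and "k \<ge> 1"
  defines "h \<equiv> hazard M (X 1) j"
    and "d \<equiv> d_coeff M (X 1) j k"
  shows "(AE \<omega> in M. N_count X j k \<omega> < \<infinity> \<and> hazard_est X j k \<omega> \<in> \<rat> \<inter> {0..<1})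
    \<and> (\<forall>a b :: nat. a < b \<and> gcd a b = 1 \<longrightarrow>
         (let t = (\<lambda>i :: nat. real ((b * i - 1) choose (a * i)) * h ^ (a * i)
                     * (1 - d) ^ ((b - a) * i - 1))
          in summable (\<lambda>i. t (i + 1))
           \<and> measure M {\<omega> \<in> space M. hazard_est X j k \<omega> = real a / real b}
               = (d - h) * (\<Sum>i. t (i + 1))))
    \<and> (\<forall>x :: real. 0 \<le> x \<and> x < 1 \<longrightarrow>
         (let u = (\<lambda>m :: nat. (1 - d) ^ m
                     * (\<Sum>l=0..nat \<lfloor>(1 + real m) * x / (1 - x)\<rfloor>. real ((m + l) choose l) * h ^ l))
          in summable u
           \<and> measure M {\<omega> \<in> space M. hazard_est X j k \<omega> \<le> x} = (d - h) * (\<Sum>m. u m)))"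
proof -
  interpret prob_space M by fact
  interpret iid_nat_sequence M X
    using assms(2,3) by unfold_locales blast+
  have point_mass: "point_mass M (X 1) i = law {i}" for i
    by (simp add: point_mass_def law_def)
  \<comment> \<open>Infinite support provides an atom beyond \<open>j + k\<close>, so the stopping
    set has positive probability.\<close>
  obtain r where r: "r > j + k" "point_mass M (X 1) r > 0"
    using assms(4) unfolding infinite_nat_iff_unbounded by blast
  have "law {r} \<le> law {j + k<..}"
    unfolding law_def using r(1) by (intro finite_measure_mono) auto
  then have "law {j + k<..} > 0"
    using r(2) unfolding point_mass by linarith
  \<comment> \<open>Values below \<open>j\<close> lie in none of the three sets: they neither stop
    the sequence nor change a count.\<close>
  then interpret stopped_iid_nat_sequence M X "{j + k<..}" "{j}" "{j<..j + k}"
    by unfold_locales auto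

  have "{j..} = {j} \<union> ({j<..j + k} \<union> {j + k<..})"
    by auto
  also have "law \<dots> = law {j} + law ({j<..j + k} \<union> {j + k<..})"
    by (rule law_union) auto
  also have "law ({j<..j + k} \<union> {j + k<..}) = law {j<..j + k} + law {j + k<..}"
    by (rule law_union) auto
  finally have "law {j..} = total"
    by (simp add: total_def)
  moreover have "int j - 1 < int y \<longleftrightarrow> j \<le> y" for y
    by auto
  ultimately have tail: "tail_prob M (X 1) (int j - 1) = total"
    by (simp add: tail_prob_def law_def)
  have h: "h = law {j} / total"
    unfolding h_def hazard_def point_mass tail ..
  have "(\<Sum>i=1..n. law {j + i}) = law {j<..j + n}" for n
  proof (induction n)
    case 0
    show ?case
      by (simp add: law_def)
  next
    case (Suc n)
    have "{j<..j + Suc n} = {j<..j + n} \<union> {j + Suc n}"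
      by auto
    also have "law \<dots> = law {j<..j + n} + law {j + Suc n}"
      by (rule law_union) auto
    finally show ?case
      using Suc by simp
  qed
  then have d: "1 - d = law {j<..j + k} / total"
    unfolding d_def d_coeff_def cond_mass_def point_mass tail
    by (simp flip: sum_divide_distrib)
  \<comment> \<open>The three fractions are \<open>h\<close>, \<open>1 - d\<close> and the
    conditional probability of exceeding \<open>j + k\<close>, so the last one equals
    \<open>d - h\<close>.\<close>
  have "1 = law {j} / total + law {j<..j + k} / total + law {j + k<..} / total"
    using total_pos by (simp add: total_def flip: add_divide_distrib)
  then have dh: "d - h = law {j + k<..} / total"
    using h d by linarith
  then have dh_pos: "d - h > 0"
    using law_S_pos total_pos by simp
  have prob_eq: "prob (stopped l m) = (d - h) * (real ((m + l) choose l) * h ^ l * (1 - d) ^ m)" for l m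
    unfolding prob_stopped dh[symmetric] h[symmetric] d[symmetric] ..
  have counts: "N_count X j k \<omega> = of_nat (1 + l + m)" "hazard_est X j k \<omega> = real l / real (1 + l + m)"
    if "\<omega> \<in> stopped l m" for \<omega> l m
    using that counts_stopped by (auto simp: stopped_def)

  have ae: "AE \<omega> in M. N_count X j k \<omega> < \<infinity> \<and> hazard_est X j k \<omega> \<in> \<rat> \<inter> {0..<1}"
    using AE_stopped
  proof (rule AE_mp, intro AE_I2 impI)
    fix \<omega> assume "\<exists>l m. \<omega> \<in> stopped l m"
    then obtain l m where "\<omega> \<in> stopped l m"
      by auto
    note * = counts[OF this]
    have "N_count X j k \<omega> < \<infinity>"
      unfolding *(1) by (simp add: less_top[symmetric])
    moreover have "hazard_est X j k \<omega> \<in> \<rat>"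
      unfolding *(2) by (intro Rats_divide Rats_of_nat)
    moreover have "hazard_est X j k \<omega> \<in> {0..<1}"
      unfolding *(2) by simp
    ultimately show "N_count X j k \<omega> < \<infinity> \<and> hazard_est X j k \<omega> \<in> \<rat> \<inter> {0..<1}"
      by blast
  qed
  have pmf: "summable (\<lambda>i. t (i + 1)) \<and>
      prob {\<omega> \<in> space M. hazard_est X j k \<omega> = real a / real b} = (d - h) * (\<Sum>i. t (i + 1))"
    if ab: "a < b" "gcd a b = 1"
      and t: "t = (\<lambda>i. real ((b * i - 1) choose (a * i)) * h ^ (a * i) * (1 - d) ^ ((b - a) * i - 1))"
    for a b :: nat and t
  proof -
    let ?E = "{\<omega> \<in> space M. hazard_est X j k \<omega> = real a / real b}"
    \<comment> \<open>The only pair with ratio \<open>a / b\<close> and denominator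
      \<open>1 + l + m = b * Suc i\<close>; the block index \<open>i\<close> is the index of the
      stated series minus one.\<close>
    define C where "C i = {(a * Suc i, (b - a) * Suc i - 1)}" for i
    note denom = numerator_add_index[OF ab(1)]
    have "(\<lambda>i. \<Sum>(l, m)\<in>C i. prob (stopped l m)) sums prob ?E"
    proof (rule sums_prob_stopped)
      show "disjoint_family C"
        unfolding disjoint_family_on_def
      proof (intro ballI impI)
        fix i i' :: nat assume "i \<noteq> i'"
        \<comment> \<open>Disjointness is read off from the sum \<open>l + m\<close>, since the
          first components all coincide when \<open>a = 0\<close>.\<close>
        moreover have "b * Suc i - 1 \<noteq> b * Suc i' - 1" if "i \<noteq> i'"
        proof -
          have "b * Suc i \<noteq> b * Suc i'" "b * Suc i \<ge> 1" "b * Suc i' \<ge> 1"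
            using that ab(1) by auto
          then show ?thesis
            by linarith
        qed
        ultimately show "C i \<inter> C i' = {}"
          using denom[of i] denom[of i'] by (auto simp: C_def simp del: mult_Suc_right)
      qed
      fix \<omega> l m assume \<omega>: "\<omega> \<in> stopped l m"
      then have "\<omega> \<in> space M"
        by (simp add: stopped_def)
      then have "\<omega> \<in> ?E \<longleftrightarrow> (\<exists>i. l = a * Suc i \<and> m = (b - a) * Suc i - 1)"
        unfolding mem_Collect_eq counts(2)[OF \<omega>]
        using ratio_eq_iff[OF ab(1), of l m] ab(2) by (simp add: coprime_iff_gcd_eq_1)
      then show "\<omega> \<in> ?E \<longleftrightarrow> (l, m) \<in> (\<Union>i. C i)"
        by (simp add: C_def)
    qed (simp_all add: C_def)
    moreover have "(\<Sum>(l, m)\<in>C i. prob (stopped l m)) = (d - h) * t (i + 1)" for i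
      using denom[of i] by (simp add: C_def t prob_eq del: mult_Suc_right)
    ultimately show ?thesis
      using dh_pos by (intro sums_cmult_left_D) simp_all
  qed
  have cdf: "summable u \<and> prob {\<omega> \<in> space M. hazard_est X j k \<omega> \<le> x} = (d - h) * (\<Sum>m. u m)"
    if x: "0 \<le> x" "x < 1"
      and u: "u = (\<lambda>m. (1 - d) ^ m
        * (\<Sum>l=0..nat \<lfloor>(1 + real m) * x / (1 - x)\<rfloor>. real ((m + l) choose l) * h ^ l))"
    for x :: real and u
  proof -
    let ?E = "{\<omega> \<in> space M. hazard_est X j k \<omega> \<le> x}"
    let ?L = "\<lambda>m :: nat. {0..nat \<lfloor>(1 + real m) * x / (1 - x)\<rfloor>}"
    \<comment> \<open>For each \<open>m\<close> the admissible \<open>l\<close> form an initial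
      segment, which is finite because \<open>x < 1\<close>.\<close>
    define C where "C m = ?L m \<times> {m}" for m
    have "(\<lambda>i. \<Sum>(l, m)\<in>C i. prob (stopped l m)) sums prob ?E"
    proof (rule sums_prob_stopped)
      show "disjoint_family C"
        by (auto simp: disjoint_family_on_def C_def)
      fix \<omega> l m assume \<omega>: "\<omega> \<in> stopped l m"
      then have "\<omega> \<in> space M"
        by (simp add: stopped_def)
      then have "\<omega> \<in> ?E \<longleftrightarrow> l \<in> ?L m"
        unfolding mem_Collect_eq counts(2)[OF \<omega>] ratio_le_iff[OF x] by simp
      then show "\<omega> \<in> ?E \<longleftrightarrow> (l, m) \<in> (\<Union>i. C i)"
        by (simp add: C_def)
    qed (simp_all add: C_def)
    moreover have "(\<Sum>(l, m)\<in>C m'. prob (stopped l m)) = (d - h) * u m'" for m'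
    proof -
      have "(\<Sum>(l, m)\<in>C m'. prob (stopped l m)) = (\<Sum>l\<in>?L m'. prob (stopped l m'))"
        unfolding C_def by (simp flip: sum.cartesian_product)
      also have "\<dots> = (d - h) * u m'"
        unfolding u prob_eq sum_distrib_left by (rule sum.cong) (simp_all add: mult_ac)
      finally show ?thesis .
    qed
    ultimately show ?thesis
      using dh_pos by (intro sums_cmult_left_D) simp_all
  qed
  show ?thesis
    unfolding Let_def
    by (intro conjI[OF ae] conjI[of "All _"] allI impI; elim conjE)
      (rule pmf[OF _ _ refl] cdf[OF _ _ refl]; assumption)+
qed

end
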